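(* Let $\mathcal{I}\subset\mathbb{R}$ be an interval and $f:\mathcal{I}\to\mathbb{R}$ a continuous strictly increasing function. Let $\{X_n : n\ge1\}$ be i.i.d. $\mathcal{I}$-valued random variables on a probability space $(\Omega,\mathcal{F},\mathbb{P})$, let $X$ be a random variable with their common distribution, and suppose $E[f(X)^2]<\infty$. For $N\ge 1$, the estimator $$\hat m_N(X)=f^{-1}\Big(\frac1N\big(f(X_1)+\dots+f(X_N)\big)\Big)$$ is an unbiased estimator of $E_f[X]$, in the sense that $E_f[\hat m_N(X)]=E_f[X]$.
   Context: $E$ denotes expectation with respect to $\mathbb{P}$. For an $\mathcal{I}$-valued random variable $Y$ with $E[|f(Y)|]<\infty$, the generalized $f$-mean is $E_f[Y]=f^{-1}\big(E[f(Y)]\big)$, where $f^{-1}$ is defined on $f(\mathcal{I})$. *)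

theory Defs
  imports "HOL-Probability.Probability"
begin

text \<open>
  A function on an interval \<open>I\<close> is represented by a total function \<open>f\<close> on the reals, whose values
  outside \<open>I\<close> are irrelevant. Its inverse, defined on \<open>f ` I\<close> only, is \<open>the_inv_into I f\<close>, which is
  unspecified outside \<open>f ` I\<close>.
\<close>

definition f_mean :: "'a measure \<Rightarrow> real set \<Rightarrow> (real \<Rightarrow> real) \<Rightarrow> ('a \<Rightarrow> real) \<Rightarrow> real" where
  "f_mean M I f Y = the_inv_into I f (\<integral>\<omega>. f (Y \<omega>) \<partial>M)"

text \<open>
  The Bochner integral and \<open>the_inv_into\<close> are total. The next predicate says that \<open>f_mean M I f Y\<close>
  is not a default value: \<open>Y\<close> is an \<open>I\<close>-valued random variable, the expectation of \<open>f Y\<close> exists, and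
  it lies in the domain of the inverse.
\<close>

definition f_mean_defined ::
  "'a measure \<Rightarrow> real set \<Rightarrow> (real \<Rightarrow> real) \<Rightarrow> ('a \<Rightarrow> real) \<Rightarrow> bool" where
  "f_mean_defined M I f Y \<longleftrightarrow>
     Y \<in> borel_measurable M \<and> (\<forall>\<omega>\<in>space M. Y \<omega> \<in> I) \<and>
     integrable M (\<lambda>\<omega>. f (Y \<omega>)) \<and> (\<integral>\<omega>. f (Y \<omega>) \<partial>M) \<in> f ` I"

definition sample_avg :: "(real \<Rightarrow> real) \<Rightarrow> (nat \<Rightarrow> 'a \<Rightarrow> real) \<Rightarrow> nat \<Rightarrow> 'a \<Rightarrow> real" where
  "sample_avg f X N \<omega> = (1 / real N) * (\<Sum>n=1..N. f (X n \<omega>))"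

definition f_mean_estimator ::
  "real set \<Rightarrow> (real \<Rightarrow> real) \<Rightarrow> (nat \<Rightarrow> 'a \<Rightarrow> real) \<Rightarrow> nat \<Rightarrow> 'a \<Rightarrow> real" where
  "f_mean_estimator I f X N \<omega> = the_inv_into I f (sample_avg f X N \<omega>)"

end

theory Submission
  imports Defs
begin

text \<open>
  The estimator is built so that \<open>f\<close> undoes its outer inverse: as a convex combination of values of
  \<open>f\<close>, the sample average lies in \<open>f ` I\<close>, hence \<open>f\<close> of the estimator is the sample average itself.
  The expectation of that is \<open>E[f(X)]\<close> by linearity and equality of the laws, and applying the
  inverse gives the equality of the two generalized means.

  The rest is well-definedness. Continuity makes \<open>f ` I\<close> an interval; an interval
  contains the averages of its points (lemma \<open>convex_average_mem\<close>) and the expectations of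
  random variables with values in it (lemma \<open>expectation_mem_interval\<close>), so all arguments of the
  inverse are in its domain. The estimator is measurable because the inverse of a strictly
  increasing function is monotone.
\<close>

lemma convex_average_mem:
  fixes S :: "real set"
  assumes "convex S" and "N \<ge> 1" and "\<And>n. n \<in> {1..N} \<Longrightarrow> y n \<in> S"
  shows "(1 / real N) * (\<Sum>n=1..N. y n) \<in> S"
proof -
  have "(\<Sum>n\<in>{1..N}. (1 / real N) *\<^sub>R y n) \<in> S"
    using assms by (intro convex_sum) auto
  then show ?thesis by (simp add: sum_distrib_left)
qed

text \<open>
  For a closed interval this is monotonicity of the integral. An endpoint missing from \<open>J\<close> cannot
  be attained as the mean either, because a strict bound on a random variable is a strict bound on
  its mean. Arguing by contradiction treats all shapes of intervals at once: a point outside \<open>J\<close>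
  has all of \<open>J\<close> strictly on one side.
\<close>
lemma (in prob_space) expectation_mem_interval:
  fixes Z :: "'a \<Rightarrow> real"
  assumes J: "is_interval J" and Z: "integrable M Z" and mem: "\<And>\<omega>. \<omega> \<in> space M \<Longrightarrow> Z \<omega> \<in> J"
  shows "expectation Z \<in> J"
proof (rule ccontr)
  assume out: "expectation Z \<notin> J"
  have "(\<forall>z\<in>J. z < expectation Z) \<or> (\<forall>z\<in>J. expectation Z < z)"
    using J out unfolding is_interval_1 by (meson linorder_not_less)
  then show False
  proof
    assume "\<forall>z\<in>J. z < expectation Z"
    then have "expectation Z < expectation Z"
      using Z mem by (intro expectation_less) auto
    then show False by simp
  next
    assume "\<forall>z\<in>J. expectation Z < z"
    then have "expectation Z < expectation Z"
      using Z mem by (intro expectation_greater) auto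
    then show False by simp
  qed
qed

lemma strict_mono_on_the_inv_into:
  fixes f :: "'a::linorder \<Rightarrow> 'b::linorder"
  assumes "strict_mono_on I f"
  shows "strict_mono_on (f ` I) (the_inv_into I f)"
proof (rule strict_mono_onI)
  fix r s assume "r \<in> f ` I" "s \<in> f ` I" "r < s"
  then obtain x y where xy: "x \<in> I" "y \<in> I" "r = f x" "s = f y" "f x < f y" by auto
  then have "x < y" using assms by (simp add: strict_mono_on_less)
  then show "the_inv_into I f r < the_inv_into I f s"
    using xy strict_mono_on_imp_inj_on[OF assms] by (simp add: the_inv_into_f_f)
qed

lemma measurable_mono_on_compose:
  fixes g :: "real \<Rightarrow> real" and Y :: "'a \<Rightarrow> real"
  assumes "mono_on A g" and "Y \<in> borel_measurable M" and "\<And>\<omega>. \<omega> \<in> space M \<Longrightarrow> Y \<omega> \<in> A"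
  shows "(\<lambda>\<omega>. g (Y \<omega>)) \<in> borel_measurable M"
proof (rule measurable_compose[where f = Y and g = g])
  show "Y \<in> measurable M (restrict_space borel A)"
    using assms(2,3) by (auto intro: measurable_restrict_space2)
  show "g \<in> borel_measurable (restrict_space borel A)"
    using assms(1) by (rule borel_measurable_mono_on_fnc)
qed

text \<open>
  \<open>f\<close> need not be measurable outside \<open>I\<close>, so the change of variables is applied to its extension
  by zero.
\<close>
lemma expectation_mono_on_eq_distr:
  fixes f :: "real \<Rightarrow> real" and X Y :: "'a \<Rightarrow> real"
  assumes I: "I \<in> sets borel" and f: "mono_on I f"
    and X: "X \<in> borel_measurable M" "\<And>\<omega>. \<omega> \<in> space M \<Longrightarrow> X \<omega> \<in> I"
    and Y: "Y \<in> borel_measurable M" "\<And>\<omega>. \<omega> \<in> space M \<Longrightarrow> Y \<omega> \<in> I"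
    and eq: "distr M borel Y = distr M borel X"
  shows "integrable M (\<lambda>\<omega>. f (Y \<omega>)) \<longleftrightarrow> integrable M (\<lambda>\<omega>. f (X \<omega>))"
    and "(\<integral>\<omega>. f (Y \<omega>) \<partial>M) = (\<integral>\<omega>. f (X \<omega>) \<partial>M)"
proof -
  define h where "h x = indicator I x * f x" for x :: real
  have h: "h \<in> borel_measurable borel"
    using borel_measurable_mono_on_fnc[OF f] I
    unfolding h_def by (subst (asm) borel_measurable_restrict_space_iff) auto
  have integrable_h: "integrable (distr M borel Z) h \<longleftrightarrow> integrable M (\<lambda>\<omega>. f (Z \<omega>))"
    and integral_h: "integral\<^sup>L (distr M borel Z) h = (\<integral>\<omega>. f (Z \<omega>) \<partial>M)"
    if "Z \<in> borel_measurable M" "\<And>\<omega>. \<omega> \<in> space M \<Longrightarrow> Z \<omega> \<in> I" for Z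
    using that h
    by (auto simp: integrable_distr_eq integral_distr h_def
        intro!: Bochner_Integration.integrable_cong Bochner_Integration.integral_cong)
  show "integrable M (\<lambda>\<omega>. f (Y \<omega>)) \<longleftrightarrow> integrable M (\<lambda>\<omega>. f (X \<omega>))"
    using integrable_h[OF X] integrable_h[OF Y] eq by simp
  show "(\<integral>\<omega>. f (Y \<omega>) \<partial>M) = (\<integral>\<omega>. f (X \<omega>) \<partial>M)"
    using integral_h[OF X] integral_h[OF Y] eq by simp
qed

theorem theorem6p1:
  fixes M :: "'a measure"
    and I :: "real set"
    and f :: "real \<Rightarrow> real"
    and Xs :: "nat \<Rightarrow> 'a \<Rightarrow> real"
    and X :: "'a \<Rightarrow> real"
    and N :: nat
  assumes "prob_space M"
    and "is_interval I"
    and "continuous_on I f"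
    and "strict_mono_on I f"
    and "prob_space.indep_vars M (\<lambda>_. borel) Xs {1..}"
    and "\<And>n \<omega>. n \<ge> 1 \<Longrightarrow> \<omega> \<in> space M \<Longrightarrow> Xs n \<omega> \<in> I"
    and "X \<in> borel_measurable M"
    and "\<And>\<omega>. \<omega> \<in> space M \<Longrightarrow> X \<omega> \<in> I"
    and "\<And>n. n \<ge> 1 \<Longrightarrow> distr M borel (Xs n) = distr M borel X"
    and "integrable M (\<lambda>\<omega>. (f (X \<omega>))\<^sup>2)"
    and "N \<ge> 1"
  shows "f_mean_defined M I f X
    \<and> (\<forall>\<omega>\<in>space M. sample_avg f Xs N \<omega> \<in> f ` I)
    \<and> f_mean_defined M I f (f_mean_estimator I f Xs N)
    \<and> f_mean M I f (f_mean_estimator I f Xs N) = f_mean M I f X"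
proof -
  interpret prob_space M by fact
  note mono = strict_mono_on_imp_mono_on[OF \<open>strict_mono_on I f\<close>]
  note inj = strict_mono_on_imp_inj_on[OF \<open>strict_mono_on I f\<close>]
  have J: "is_interval (f ` I)"
    using assms(2,3) by (simp add: is_interval_connected_1 connected_continuous_image)
  have Xs: "Xs n \<in> borel_measurable M" if "n \<ge> 1" for n
    using assms(5) that by (auto simp: indep_vars_def)
  have meas_fX: "(\<lambda>\<omega>. f (X \<omega>)) \<in> borel_measurable M"
    using assms(7,8) by (rule measurable_mono_on_compose[OF mono])
  have int_fX: "integrable M (\<lambda>\<omega>. f (X \<omega>))"
    using meas_fX assms(10) by (rule square_integrable_imp_integrable)
  have mean_mem: "expectation (\<lambda>\<omega>. f (X \<omega>)) \<in> f ` I"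
    using J int_fX assms(8) by (intro expectation_mem_interval) auto
  have avg_mem: "sample_avg f Xs N \<omega> \<in> f ` I" if "\<omega> \<in> space M" for \<omega>
    unfolding sample_avg_def
    using J assms(6,11) that by (intro convex_average_mem) (auto simp: is_interval_convex_1)
  have int_fXs: "integrable M (\<lambda>\<omega>. f (Xs n \<omega>))"
    and mean_fXs: "expectation (\<lambda>\<omega>. f (Xs n \<omega>)) = expectation (\<lambda>\<omega>. f (X \<omega>))"
    if n: "n \<ge> 1" for n
    using expectation_mono_on_eq_distr[OF real_interval_borel_measurable[OF assms(2)] mono assms(7,8)
        Xs[OF n] assms(6)[OF n] assms(9)[OF n]] int_fX by auto
  have int_avg: "integrable M (sample_avg f Xs N)"
    unfolding sample_avg_def[abs_def]
    using int_fXs by (intro integrable_mult_right Bochner_Integration.integrable_sum) auto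
  have mean_avg: "expectation (sample_avg f Xs N) = expectation (\<lambda>\<omega>. f (X \<omega>))"
    unfolding sample_avg_def[abs_def] using int_fXs mean_fXs \<open>N \<ge> 1\<close>
    by (simp add: Bochner_Integration.integral_sum)
  have est_mem: "f_mean_estimator I f Xs N \<omega> \<in> I"
    and f_est: "f (f_mean_estimator I f Xs N \<omega>) = sample_avg f Xs N \<omega>"
    if "\<omega> \<in> space M" for \<omega>
    unfolding f_mean_estimator_def using avg_mem[OF that] inj
    by (auto simp: the_inv_into_into f_the_inv_into_f)
  have mono_inv: "mono_on (f ` I) (the_inv_into I f)"
    using strict_mono_on_the_inv_into[OF \<open>strict_mono_on I f\<close>]
    by (rule strict_mono_on_imp_mono_on)
  have "(\<lambda>\<omega>. the_inv_into I f (sample_avg f Xs N \<omega>)) \<in> borel_measurable M"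
    using borel_measurable_integrable[OF int_avg] avg_mem
    by (rule measurable_mono_on_compose[OF mono_inv])
  then have meas_est: "f_mean_estimator I f Xs N \<in> borel_measurable M"
    unfolding f_mean_estimator_def[abs_def] .
  have int_f_est: "integrable M (\<lambda>\<omega>. f (f_mean_estimator I f Xs N \<omega>))"
    using int_avg f_est by (simp cong: Bochner_Integration.integrable_cong)
  have mean_f_est: "expectation (\<lambda>\<omega>. f (f_mean_estimator I f Xs N \<omega>))
      = expectation (\<lambda>\<omega>. f (X \<omega>))"
    using mean_avg f_est by (simp cong: Bochner_Integration.integral_cong)
  show ?thesis
    unfolding f_mean_defined_def f_mean_def
    using assms(7,8) int_fX mean_mem avg_mem meas_est est_mem int_f_est mean_f_est by simp
qed

end
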